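(* Let $Q$ be a finite connected quandle of order $n$ with elements $1,2,\dots,n$ naturally ordered, and with profile $\{1,n-1\}$ or $\{1,1,n-2\}$. Then the set of all automorphisms of $Q$ coincides with the set of all natural reorderings of $Q$.
   Context: A quandle is a set $Q$ with a binary operation $*$ such that: (1) $a*a=a$ for all $a\in Q$; (2) for all $a,b\in Q$ there is a unique $c\in Q$ with $a=c*b$; (3) $(a*b)*c=(a*c)*(b*c)$ for all $a,b,c\in Q$. For $b\in Q$ let $r_b:Q\to Q$, $r_b(x)=x*b$ (a bijection), and write $a\,\bar{*}\,b=r_b^{-1}(a)$. An automorphism of $Q$ is a bijection $f:Q\to Q$ with $f(a*b)=f(a)*f(b)$ for all $a,b$. $Q$ is connected if for every $a\in Q$ the orbit $\{(\cdots((a\star_1 b_1)\star_2 b_2)\cdots\star_m b_m) : m\ge 0,\ b_i\in Q,\ \star_i\in\{*,\bar{*}\}\}$ equals $Q$. Let $Q$ be a finite connected quandle with underlying set $\{1,\dots,n\}$. In this case all the permutations $r_1,\dots,r_n$ are conjugate in the symmetric group; the profile of $Q$ is the multiset of lengths of the cycles in the disjoint cycle decomposition of $r_n$ (cycles of length $1$ included). The cycle notation $(i_1\ i_2\ \cdots\ i_\ell)$ means $i_1\mapsto i_2\mapsto\cdots\mapsto i_\ell\mapsto i_1$. Natural reordering: a bijection $\nu:\{1,\dots,n\}\to\{1,\dots,n\}$ is a natural reordering with respect to $r_q$ ($q\in Q$) if for some presentation of $r_q$ as a product of disjoint cycles $r_q=(i_{11}\ i_{12}\cdots i_{1\ell_1})(i_{21}\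 i_{22}\cdots i_{2\ell_2})\cdots(i_{k1}\ i_{k2}\cdots i_{k\ell_k})(q)$ with $1\le\ell_1\le\ell_2\le\cdots\le\ell_k$, one has $\nu(q)=n$ and $\nu(i_{st})=\bigl(\sum_{j=1}^{s-1}\ell_j\bigr)+t$ for all $1\le s\le k$, $1\le t\le \ell_s$. A natural reordering of $Q$ is a bijection that is a natural reordering with respect to $r_q$ for some $q\in Q$. The elements of $Q$ are naturally ordered if, for some $1\le\ell_1\le\cdots\le\ell_k$, $r_n=(1\ 2\cdots \ell_1)(\ell_1+1\ \cdots\ \ell_1+\ell_2)\cdots\bigl(\sum_{j=1}^{k-1}\ell_j+1\ \cdots\ \sum_{j=1}^{k-1}\ell_j+\ell_k\bigr)(n)$. *)

theory Defs
  imports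
    "HOL-Library.Multiset"
    "HOL-Combinatorics.Permutations"
    "HOL-Combinatorics.Cycles"
    "HOL-Combinatorics.Orbits"
begin

locale quandle =
  fixes Q :: "'a set" and mul :: "'a \<Rightarrow> 'a \<Rightarrow> 'a"
  assumes closed: "\<lbrakk>a \<in> Q; b \<in> Q\<rbrakk> \<Longrightarrow> mul a b \<in> Q"
    and idem: "a \<in> Q \<Longrightarrow> mul a a = a"
    and right_divide: "\<lbrakk>a \<in> Q; b \<in> Q\<rbrakk> \<Longrightarrow> \<exists>!c. c \<in> Q \<and> a = mul c b"
    and self_distrib: "\<lbrakk>a \<in> Q; b \<in> Q; c \<in> Q\<rbrakk> \<Longrightarrow> mul (mul a b) c = mul (mul a c) (mul b c)"

text \<open>Bijections of the carrier \<open>Q\<close> are represented throughout as in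
  \<^const>\<open>permutes\<close>: functions on the whole type that are the identity outside \<open>Q\<close>.
  Hence equality of functions is equality on \<open>Q\<close>, and \<^const>\<open>inv\<close> is the inverse
  bijection of \<open>Q\<close>.\<close>

definition right_mult :: "'a set \<Rightarrow> ('a \<Rightarrow> 'a \<Rightarrow> 'a) \<Rightarrow> 'a \<Rightarrow> 'a \<Rightarrow> 'a" where
  "right_mult Q mul b = (\<lambda>x. if x \<in> Q then mul x b else x)"

lemma (in quandle) right_mult_permutes:
  assumes "b \<in> Q"
  shows "right_mult Q mul b permutes Q"
proof (rule bij_imp_permutes)
  show "bij_betw (right_mult Q mul b) Q Q"
    unfolding bij_betw_def inj_on_def image_def right_mult_def
    using assms closed right_divide by (auto, metis, metis)
qed (simp add: right_mult_def)

definition quandle_aut :: "'a set \<Rightarrow> ('a \<Rightarrow> 'a \<Rightarrow> 'a) \<Rightarrow> ('a \<Rightarrow> 'a) \<Rightarrow> bool" where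
  "quandle_aut Q mul f \<longleftrightarrow>
     f permutes Q \<and> (\<forall>a\<in>Q. \<forall>b\<in>Q. f (mul a b) = mul (f a) (f b))"

inductive_set quandle_orbit :: "'a set \<Rightarrow> ('a \<Rightarrow> 'a \<Rightarrow> 'a) \<Rightarrow> 'a \<Rightarrow> 'a set"
  for Q mul a where
  base: "a \<in> quandle_orbit Q mul a"
| mul: "\<lbrakk>x \<in> quandle_orbit Q mul a; b \<in> Q\<rbrakk> \<Longrightarrow> mul x b \<in> quandle_orbit Q mul a"
| bar: "\<lbrakk>x \<in> quandle_orbit Q mul a; b \<in> Q\<rbrakk>
    \<Longrightarrow> inv (right_mult Q mul b) x \<in> quandle_orbit Q mul a"

definition quandle_connected :: "'a set \<Rightarrow> ('a \<Rightarrow> 'a \<Rightarrow> 'a) \<Rightarrow> bool" where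
  "quandle_connected Q mul \<longleftrightarrow> (\<forall>a\<in>Q. quandle_orbit Q mul a = Q)"

text \<open>\<open>cycle_presentation Q p cs\<close>: the list \<open>cs\<close> presents \<open>p\<close> as a product of disjoint
  cycles in which every element of \<open>Q\<close> is written exactly once, fixed points appearing as
  cycles of length \<open>1\<close>.\<close>

definition cycle_presentation :: "'a set \<Rightarrow> ('a \<Rightarrow> 'a) \<Rightarrow> 'a list list \<Rightarrow> bool" where
  "cycle_presentation Q p cs \<longleftrightarrow>
     [] \<notin> set cs \<and> distinct (concat cs) \<and> set (concat cs) = Q \<and>
     p = foldr (\<circ>) (map cycle_of_list cs) id"

definition cycle_lengths :: "'a set \<Rightarrow> ('a \<Rightarrow> 'a) \<Rightarrow> nat multiset" where
  "cycle_lengths Q p = image_mset card (mset_set (orbit p ` Q))"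

lemma cycle_of_list_nth:
  assumes "distinct c" "i < length c"
  shows "cycle_of_list c (c ! i) = c ! (Suc i mod length c)"
proof -
  have "map (cycle_of_list c) c ! i = rotate 1 c ! i"
    using cyclic_rotation[OF assms(1), of 1] by simp
  then show ?thesis
    using assms(2) nth_rotate[of i c 1] by simp
qed

lemma foldr_cycles_apply:
  assumes "distinct (concat cs)"
  shows "c \<in> set cs \<Longrightarrow> x \<in> set c \<Longrightarrow>
    foldr (\<circ>) (map cycle_of_list cs) id x = cycle_of_list c x"
    and "x \<notin> set (concat cs) \<Longrightarrow> foldr (\<circ>) (map cycle_of_list cs) id x = x"
  using assms
proof (induction cs)
  case (Cons d ds)
  {
    case 1
    show ?case
    proof (cases "c \<in> set ds")
      case True
      have "cycle_of_list c x \<in> set c"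
        using permutes_in_image[OF cycle_permutes] 1 by metis
      then have "cycle_of_list c x \<notin> set d"
        using 1 True by auto
      then show ?thesis
        using Cons.IH(1) 1 True by (simp add: id_outside_supp)
    next
      case False
      then have "c = d" "x \<notin> set (concat ds)" using 1 by auto
      then show ?thesis using Cons.IH(2) 1 by simp
    qed
  next
    case 2
    then show ?case using Cons.IH(2) by (simp add: id_outside_supp)
  }
qed simp_all

lemma cycle_lengths_presentation:
  assumes "cycle_presentation Q p cs"
  shows "cycle_lengths Q p = mset (map length cs)"
proof -
  have ne: "[] \<notin> set cs" and dc: "distinct (concat cs)" and Q: "set (concat cs) = Q"
    and p: "p = foldr (\<circ>) (map cycle_of_list cs) id"
    using assms by (auto simp: cycle_presentation_def)
  have orb: "orbit p x = set c" if c: "c \<in> set cs" and x: "x \<in> set c" for c x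
  proof -
    have d: "distinct c" using dc c by (simp add: distinct_concat_iff)
    have step: "p (c ! i) = c ! (Suc i mod length c)" if "i < length c" for i
      using foldr_cycles_apply(1)[OF dc c, of "c ! i"] cycle_of_list_nth[OF d that] that
      by (simp add: p)
    obtain i where i: "i < length c" "x = c ! i" using x by (metis in_set_conv_nth)
    have lpos: "j mod length c < length c" for j
      using i(1) by (intro mod_less_divisor) linarith
    have pow: "(p ^^ m) x = c ! ((i + m) mod length c)" for m
    proof (induction m)
      case (Suc m)
      have "(i + m) mod length c < length c" by (rule lpos)
      from step[OF this] Suc show ?case by (simp add: mod_Suc_eq)
    qed (use i in simp)
    have "orbit p x = {(p ^^ m) x | m. m < length c}"
      by (rule orbit_altdef_bounded) (use pow[of "length c"] i in auto)
    also have "\<dots> = set c"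
    proof (intro equalityI subsetI)
      fix y assume "y \<in> {(p ^^ m) x | m. m < length c}"
      then show "y \<in> set c" using pow lpos by auto
    next
      fix y assume "y \<in> set c"
      then obtain j where j: "j < length c" "y = c ! j" by (metis in_set_conv_nth)
      define m where "m = (j + length c - i) mod length c"
      have "(i + m) mod length c = (i + (j + length c - i)) mod length c"
        by (simp add: m_def mod_add_right_eq)
      also have "\<dots> = j" using i j by simp
      finally have "(p ^^ m) x = y" using pow j by simp
      moreover have "m < length c" unfolding m_def by (rule lpos)
      ultimately show "y \<in> {(p ^^ m) x | m. m < length c}" by auto
    qed
    finally show ?thesis .
  qed
  have orbs: "orbit p ` Q = set ` set cs"
  proof (intro equalityI subsetI)
    fix A assume "A \<in> orbit p ` Q"
    then obtain x where x: "x \<in> Q" "A = orbit p x" by blast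
    then obtain c where "c \<in> set cs" "x \<in> set c" using Q by auto
    then show "A \<in> set ` set cs" using orb[of c x] x by blast
  next
    fix A assume "A \<in> set ` set cs"
    then obtain c where c: "c \<in> set cs" "A = set c" by blast
    then have hd: "hd c \<in> set c" using ne by (metis hd_in_set)
    then have "hd c \<in> Q" using c Q by auto
    then show "A \<in> orbit p ` Q" using orb[OF c(1) hd] c(2) by blast
  qed
  have "distinct (map set cs)"
    using dc ne
  proof (induction cs)
    case (Cons d ds)
    have *: "set d \<inter> set (concat ds) = {}" "d \<noteq> []" using Cons.prems by auto
    have "set d \<notin> set ` set ds"
    proof
      assume "set d \<in> set ` set ds"
      then obtain e where e: "e \<in> set ds" "set d = set e" by blast
      have "hd d \<in> set d" using *(2) by simp
      moreover have "hd d \<in> set (concat ds)" using e calculation by (simp, blast)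
      ultimately show False using *(1) by blast
    qed
    moreover have "distinct (map set ds)" using Cons by simp
    ultimately show ?case by simp
  qed simp
  then have "mset_set (orbit p ` Q) = mset (map set cs)"
    unfolding orbs by (metis list.set_map mset_set_set)
  then have "cycle_lengths Q p = mset (map (\<lambda>c. card (set c)) cs)"
    by (simp add: cycle_lengths_def image_mset.compositionality comp_def)
  also have "map (\<lambda>c. card (set c)) cs = map length cs"
    using dc by (intro map_cong refl distinct_card) (simp add: distinct_concat_iff)
  finally show ?thesis .
qed

text \<open>From here on the carrier is \<open>{1..n}\<close>.\<close>

definition profile :: "nat \<Rightarrow> (nat \<Rightarrow> nat \<Rightarrow> nat) \<Rightarrow> nat multiset" where
  "profile n mul = cycle_lengths {1..n} (right_mult {1..n} mul n)"

text \<open>Lists are indexed from \<open>0\<close>, so \<open>cs ! s ! t\<close> is the entry \<open>t + 1\<close> of the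
  cycle \<open>s + 1\<close>.\<close>

definition natural_reordering_wrt ::
  "nat \<Rightarrow> (nat \<Rightarrow> nat \<Rightarrow> nat) \<Rightarrow> nat \<Rightarrow> (nat \<Rightarrow> nat) \<Rightarrow> bool" where
  "natural_reordering_wrt n mul q \<nu> \<longleftrightarrow>
     \<nu> permutes {1..n} \<and>
     (\<exists>cs. cycle_presentation {1..n} (right_mult {1..n} mul q) (cs @ [[q]]) \<and>
           sorted (map length cs) \<and>
           \<nu> q = n \<and>
           (\<forall>s < length cs. \<forall>t < length (cs ! s).
              \<nu> (cs ! s ! t) = (\<Sum>j<s. length (cs ! j)) + (t + 1)))"

definition natural_reordering :: "nat \<Rightarrow> (nat \<Rightarrow> nat \<Rightarrow> nat) \<Rightarrow> (nat \<Rightarrow> nat) \<Rightarrow> bool" where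
  "natural_reordering n mul \<nu> \<longleftrightarrow> (\<exists>q\<in>{1..n}. natural_reordering_wrt n mul q \<nu>)"

definition naturally_ordered :: "nat \<Rightarrow> (nat \<Rightarrow> nat \<Rightarrow> nat) \<Rightarrow> bool" where
  "naturally_ordered n mul \<longleftrightarrow>
     (\<exists>ls. sorted ls \<and> (\<forall>l\<in>set ls. 1 \<le> l) \<and>
           cycle_presentation {1..n} (right_mult {1..n} mul n)
             (map (\<lambda>s. [(\<Sum>j<s. ls ! j) + 1 ..< (\<Sum>j<s. ls ! j) + ls ! s + 1]) [0..<length ls]
              @ [[n]]))"

end

theory Submission
  imports Defs
begin

text \<open>Conjugation by an automorphism \<open>g\<close> carries \<open>r_q\<close> to \<open>r_(g q)\<close>, so composing a natural
  reordering with respect to \<open>r_q\<close> with \<open>inv g\<close> yields one with respect to \<open>r_(g q)\<close>. Natural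
  ordering says that the identity is a natural reordering with respect to \<open>r_n\<close>, hence every
  automorphism is a natural reordering. Conversely, connectedness provides an automorphism
  carrying \<open>q\<close> to \<open>n\<close>, which reduces the claim to natural reorderings with respect to \<open>r_n\<close>.
  These commute with \<open>r_n\<close> and fix its fixed points; as \<open>r_n\<close> has a single nontrivial cycle,
  they are powers of \<open>r_n\<close>, which are automorphisms.\<close>

section \<open>Automorphisms, right multiplications and connectedness\<close>

lemma permutes_funpow:
  assumes "p permutes S"
  shows "(p ^^ k) permutes S"
  by (induction k) (simp_all only: funpow.simps permutes_id permutes_compose assms)

text \<open>On \<open>Q\<close> this is the homomorphism law at \<open>inv g x\<close> and
  \<open>q\<close>; off \<open>Q\<close> both sides fix \<open>x\<close>, since \<open>inv g\<close>
  preserves membership in \<open>Q\<close>.\<close>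

lemma right_mult_quandle_aut:
  assumes "quandle_aut Q mul g" "q \<in> Q"
  shows "right_mult Q mul (g q) = g \<circ> right_mult Q mul q \<circ> inv g"
proof
  fix x
  have g: "g permutes Q" using assms by (simp add: quandle_aut_def)
  have "inv g x \<in> Q \<longleftrightarrow> x \<in> Q"
    using permutes_in_image[OF permutes_inv[OF g]] by blast
  moreover have "g (inv g x) = x" using permutes_inverses[OF g] by simp
  ultimately show "right_mult Q mul (g q) x = (g \<circ> right_mult Q mul q \<circ> inv g) x"
    using assms by (auto simp: right_mult_def quandle_aut_def)
qed

lemma quandle_aut_id: "quandle_aut Q mul id"
  by (simp add: quandle_aut_def permutes_id)

lemma quandle_aut_comp:
  assumes "quandle_aut Q mul f" "quandle_aut Q mul g"
  shows "quandle_aut Q mul (f \<circ> g)"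
  using assms permutes_in_image[of g Q]
  by (auto simp: quandle_aut_def intro: permutes_compose)

lemma quandle_aut_funpow:
  assumes "quandle_aut Q mul f"
  shows "quandle_aut Q mul (f ^^ k)"
  by (induction k) (simp_all only: funpow.simps quandle_aut_comp quandle_aut_id assms)

context quandle
begin

lemma quandle_aut_inv:
  assumes "quandle_aut Q mul f"
  shows "quandle_aut Q mul (inv f)"
  unfolding quandle_aut_def
proof (intro conjI ballI)
  have f: "f permutes Q" using assms by (simp add: quandle_aut_def)
  show "inv f permutes Q" using f by (rule permutes_inv)
  fix a b assume ab: "a \<in> Q" "b \<in> Q"
  have mem: "inv f a \<in> Q" "inv f b \<in> Q"
    using permutes_in_image[OF permutes_inv[OF f]] ab by auto
  have "f (mul (inv f a) (inv f b)) = mul a b"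
    using assms mem permutes_inverses[OF f] by (simp add: quandle_aut_def)
  then show "inv f (mul a b) = mul (inv f a) (inv f b)"
    using permutes_inverses[OF f] by metis
qed

text \<open>Unique right division makes the map bijective, and self-distributivity is exactly its
  homomorphism law.\<close>

lemma quandle_aut_right_mult:
  assumes "b \<in> Q"
  shows "quandle_aut Q mul (right_mult Q mul b)"
  unfolding quandle_aut_def
proof (intro conjI ballI)
  show "right_mult Q mul b permutes Q" using assms by (rule right_mult_permutes)
  fix x y assume xy: "x \<in> Q" "y \<in> Q"
  show "right_mult Q mul b (mul x y) = mul (right_mult Q mul b x) (right_mult Q mul b y)"
    using self_distrib[OF xy assms] closed[OF xy] xy by (simp only: right_mult_def if_True)
qed

text \<open>Every step along the orbit applies a right multiplication or its inverse. Both are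
  automorphisms, so the composite of the steps is one too.\<close>

lemma quandle_orbit_aut:
  assumes "x \<in> quandle_orbit Q mul a" "a \<in> Q"
  shows "\<exists>g. quandle_aut Q mul g \<and> g a = x"
  using assms
proof (induction rule: quandle_orbit.induct)
  case base
  show ?case by (intro exI[of _ id] conjI quandle_aut_id id_apply)
next
  case (mul x b)
  then obtain g where g: "quandle_aut Q mul g" "g a = x" by blast
  then have "x \<in> Q" using mul.prems by (metis permutes_in_image quandle_aut_def)
  then have "(right_mult Q mul b \<circ> g) a = mul x b" using g by (simp add: right_mult_def)
  with quandle_aut_comp[OF quandle_aut_right_mult[OF mul.hyps(2)] g(1)]
  show ?case by (intro exI conjI)
next
  case (bar x b)
  then obtain g where g: "quandle_aut Q mul g" "g a = x" by blast
  have "(inv (right_mult Q mul b) \<circ> g) a = inv (right_mult Q mul b) x" using g by simp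
  with quandle_aut_comp[OF quandle_aut_inv[OF quandle_aut_right_mult[OF bar.hyps(2)]] g(1)]
  show ?case by (intro exI conjI)
qed

lemma quandle_connected_aut:
  assumes "quandle_connected Q mul" "a \<in> Q" "b \<in> Q"
  obtains g where "quandle_aut Q mul g" "g a = b"
proof -
  have "quandle_orbit Q mul a = Q"
    using assms(1,2) unfolding quandle_connected_def by (rule bspec)
  then have "b \<in> quandle_orbit Q mul a" using assms(3) by (rule ssubst)
  from quandle_orbit_aut[OF this assms(2)] show thesis
    by (elim exE conjE) (rule that)
qed

text \<open>By connectedness all right multiplications are conjugate, so one trivial one makes all
  of them trivial; then the orbit of \<open>q\<close>, which is \<open>Q\<close>, cannot leave
  \<open>q\<close>. This rules out a degenerate case of the profile with two fixed points.\<close>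

lemma quandle_connected_right_mult_id:
  assumes "quandle_connected Q mul" "q \<in> Q" "right_mult Q mul q = id"
  shows "Q = {q}"
proof -
  have triv: "right_mult Q mul b = id" if "b \<in> Q" for b
  proof -
    obtain g where g: "quandle_aut Q mul g" "g q = b"
      using quandle_connected_aut[OF assms(1,2) \<open>b \<in> Q\<close>] .
    then have "g permutes Q" by (simp add: quandle_aut_def)
    then have "g \<circ> inv g = id" by (rule permutes_inv_o)
    then show ?thesis using right_mult_quandle_aut[OF g(1) assms(2)] assms(3) g(2) by simp
  qed
  have "x = q" if "x \<in> quandle_orbit Q mul q" for x
    using that
  proof (induction rule: quandle_orbit.induct)
    case (mul x b)
    have "right_mult Q mul b x = x" using triv[OF mul.hyps(2)] by simp
    then show ?case using mul.IH assms(2) by (simp add: right_mult_def)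
  qed (use triv in simp_all)
  moreover have "quandle_orbit Q mul q = Q"
    using assms(1,2) unfolding quandle_connected_def by (rule bspec)
  ultimately show ?thesis using assms(2) by blast
qed

end

section \<open>Cycle presentations under conjugation and rotation\<close>

text \<open>Conjugating one cycle by \<open>g\<close> relabels its entries by \<open>g\<close>, and
  conjugation distributes over the product of the cycles.\<close>

lemma cycle_presentation_conj:
  assumes p: "cycle_presentation Q p cs" and g: "g permutes Q"
  shows "cycle_presentation Q (g \<circ> p \<circ> inv g) (map (map g) cs)"
proof -
  have bij: "bij g" and inj: "inj g" using g permutes_bij permutes_inj by auto
  have o: "g \<circ> foldr (\<circ>) (map cycle_of_list cs) id \<circ> inv g
      = foldr (\<circ>) (map cycle_of_list (map (map g) cs)) id"
    if "distinct (concat cs)"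
    using that
  proof (induction cs)
    case Nil
    show ?case using permutes_inv_o[OF g] by simp
  next
    case (Cons c cs)
    let ?h = "foldr (\<circ>) (map cycle_of_list cs) id"
    \<comment> \<open>Insert \<open>inv g \<circ> g\<close> between the first cycle and the
      remaining ones.\<close>
    have "g \<circ> (cycle_of_list c \<circ> ?h) \<circ> inv g
        = (g \<circ> cycle_of_list c \<circ> inv g) \<circ> (g \<circ> ?h \<circ> inv g)"
      using permutes_inverses[OF g] by (simp add: fun_eq_iff)
    also have "g \<circ> cycle_of_list c \<circ> inv g = cycle_of_list (map g c)"
      using conjugation_of_cycle[OF _ bij] Cons.prems by simp
    also have "g \<circ> ?h \<circ> inv g = foldr (\<circ>) (map cycle_of_list (map (map g) cs)) id"
      using Cons.IH Cons.prems by (simp only: concat.simps distinct_append)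
    finally show ?case
      by (simp only: list.map foldr.simps comp_apply[where f = "(\<circ>) h" for h])
  qed
  have "concat (map (map g) cs) = map g (concat cs)" by (simp add: map_concat)
  then show ?thesis
    using p o inj_on_subset[OF inj] permutes_image[OF g]
    by (auto simp: cycle_presentation_def distinct_map simp del: set_concat)
qed

lemma cycle_presentation_nth:
  assumes "cycle_presentation Q p cs" "c \<in> set cs" "i < length c"
  shows "p (c ! i) = c ! (Suc i mod length c)"
proof -
  have "distinct (concat cs)" and p: "p = foldr (\<circ>) (map cycle_of_list cs) id"
    using assms(1) by (auto simp only: cycle_presentation_def)
  then have "distinct c" "p (c ! i) = cycle_of_list c (c ! i)"
    using foldr_cycles_apply(1)[of cs c "c ! i"] assms(2,3) by (auto simp: distinct_concat_iff)
  then show ?thesis using cycle_of_list_nth[OF _ assms(3)] by simp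
qed

text \<open>Two lists that follow \<open>p\<close> cyclically with the same length are rotations of
  each other as soon as they meet, and rotating by \<open>k\<close> places is applying
  \<open>p ^^ k\<close>.\<close>

lemma cycle_rotation:
  assumes c: "\<And>i. i < length c \<Longrightarrow> p (c ! i) = c ! (Suc i mod length c)"
    and d: "\<And>i. i < length c \<Longrightarrow> p (d ! i) = d ! (Suc i mod length c)"
    and d0: "d ! 0 \<in> set c"
  obtains k where "\<And>i. i < length c \<Longrightarrow> d ! i = (p ^^ k) (c ! i)"
proof -
  \<comment> \<open>The shift is the position in \<open>c\<close> of the first entry of
    \<open>d\<close>.\<close>
  obtain k where k: "k < length c" "d ! 0 = c ! k" using d0 by (metis in_set_conv_nth)
  have pow: "(p ^^ i) (e ! 0) = e ! i"
    if e: "\<And>i. i < length c \<Longrightarrow> p (e ! i) = e ! (Suc i mod length c)"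
      and "i < length c" for e i
    using that(2) by (induction i) (auto simp: e)
  have "d ! i = (p ^^ k) (c ! i)" if "i < length c" for i
  proof -
    have "d ! i = (p ^^ i) ((p ^^ k) (c ! 0))" using pow[OF d that] pow[OF c k(1)] k(2) by simp
    also have "\<dots> = (p ^^ k) ((p ^^ i) (c ! 0))" by (metis comp_apply funpow_add add.commute)
    finally show ?thesis using pow[OF c that] by simp
  qed
  then show thesis by (rule that)
qed

section \<open>Natural reorderings: transport by automorphisms and the case of
  \<open>r_n\<close>\<close>

text \<open>Relabelling the presentation by \<open>g\<close> presents \<open>r_(g q)\<close> with
  the same cycle lengths, and \<open>inv g\<close> undoes the relabelling, so every entry keeps its
  assigned position.\<close>

lemma natural_reordering_wrt_aut:
  assumes "natural_reordering_wrt n mul q \<nu>" "quandle_aut {1..n} mul g" "q \<in> {1..n}"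
  shows "natural_reordering_wrt n mul (g q) (\<nu> \<circ> inv g)"
proof -
  have g: "g permutes {1..n}" using assms(2) by (simp add: quandle_aut_def)
  obtain cs where cs: "cycle_presentation {1..n} (right_mult {1..n} mul q) (cs @ [[q]])"
      "sorted (map length cs)" "\<nu> q = n"
      "\<forall>s < length cs. \<forall>t < length (cs ! s). \<nu> (cs ! s ! t) = (\<Sum>j<s. length (cs ! j)) + (t + 1)"
    and nu: "\<nu> permutes {1..n}"
    using assms(1) by (auto simp: natural_reordering_wrt_def)
  have "cycle_presentation {1..n} (right_mult {1..n} mul (g q)) (map (map g) cs @ [[g q]])"
    using cycle_presentation_conj[OF cs(1) g] right_mult_quandle_aut[OF assms(2,3)] by simp
  moreover have "map length (map (map g) cs) = map length cs" by simp
  moreover have "\<nu> \<circ> inv g permutes {1..n}"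
    using nu permutes_inv[OF g] by (intro permutes_compose)
  ultimately show ?thesis
    using cs permutes_inverses[OF g] unfolding natural_reordering_wrt_def
    by (intro conjI exI[of _ "map (map g) cs"]) (simp_all add: comp_def)
qed

lemma naturally_ordered_reordering:
  assumes "naturally_ordered n mul"
  shows "natural_reordering_wrt n mul n id"
proof -
  obtain ls where "sorted ls" and cp: "cycle_presentation {1..n} (right_mult {1..n} mul n)
       (map (\<lambda>s. [(\<Sum>j<s. ls ! j) + 1 ..< (\<Sum>j<s. ls ! j) + ls ! s + 1]) [0..<length ls] @ [[n]])"
    (is "cycle_presentation _ _ (?cs @ _)")
    using assms by (auto simp: naturally_ordered_def)
  have len: "map length ?cs = ls" by (rule nth_equalityI) auto
  have "id (?cs ! s ! t) = (\<Sum>j<s. length (?cs ! j)) + (t + 1)"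
    if "s < length ?cs" "t < length (?cs ! s)" for s t
  proof -
    have "(\<Sum>j<s. length (?cs ! j)) = (\<Sum>j<s. ls ! j)"
      using that(1) by (intro sum.cong) auto
    then show ?thesis using that by (simp del: upt_Suc)
  qed
  then show ?thesis
    unfolding natural_reordering_wrt_def using cp \<open>sorted ls\<close> len permutes_id
    by (intro conjI exI[of _ ?cs]) (auto simp only: id_apply)
qed

text \<open>The final cycle \<open>[n]\<close> accounts for one \<open>1\<close> of the profile, and
  sortedness leaves only one order for the other lengths.\<close>

lemma natural_reordering_wrt_lengths:
  assumes "cycle_presentation {1..n} (right_mult {1..n} mul n) (cs @ [[n]])"
    and "sorted (map length cs)"
    and "profile n mul = add_mset 1 M"
  shows "map length cs = sorted_list_of_multiset M"
proof -
  have "mset (map length cs) = M"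
    using cycle_lengths_presentation[OF assms(1)] assms(3) by (simp add: profile_def)
  then show ?thesis using assms(2) by (metis sorted_list_of_multiset_mset sorted_sort_id)
qed

lemma natural_reordering_wrt_self_power:
  assumes Q: "quandle {1..n} mul" and conn: "quandle_connected {1..n} mul"
    and nat_ord: "naturally_ordered n mul"
    and prof: "profile n mul = {#1, n - 1#} \<or> profile n mul = {#1, 1, n - 2#}"
    and nu: "natural_reordering_wrt n mul n \<nu>"
  obtains k where "\<nu> = right_mult {1..n} mul n ^^ k"
proof -
  let ?r = "right_mult {1..n} mul n"
  obtain cs where cs: "cycle_presentation {1..n} ?r (cs @ [[n]])" "sorted (map length cs)" "\<nu> n = n"
      "\<And>s t. s < length cs \<Longrightarrow> t < length (cs ! s) \<Longrightarrow>
        \<nu> (cs ! s ! t) = (\<Sum>j<s. length (cs ! j)) + (t + 1)"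
    and perm: "\<nu> permutes {1..n}"
    using nu by (auto simp: natural_reordering_wrt_def)
  \<comment> \<open>In \<open>ds\<close>, the presentation given by the natural order, each entry
    equals its position. Once the lengths agree, \<open>\<nu>\<close> therefore maps
    \<open>cs\<close> to \<open>ds\<close> entry by entry.\<close>
  obtain ds where ds: "cycle_presentation {1..n} ?r (ds @ [[n]])" "sorted (map length ds)"
      "\<And>s t. s < length ds \<Longrightarrow> t < length (ds ! s) \<Longrightarrow>
        ds ! s ! t = (\<Sum>j<s. length (ds ! j)) + (t + 1)"
    using naturally_ordered_reordering[OF nat_ord] by (auto simp: natural_reordering_wrt_def)
  have nQ: "n \<in> {1..n}" using cs(1) by (auto simp: cycle_presentation_def)
  have r: "?r permutes {1..n}" using quandle.right_mult_permutes[OF Q nQ] .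
  have rn: "(?r ^^ k) x = x" if "?r x = x" for k x
    by (induction k) (use that in auto)
  have fixn: "?r n = n" using cycle_presentation_nth[OF cs(1), of "[n]" 0] by simp
  have pos: "\<forall>l \<in> set (map length cs). 0 < l"
    using cs(1) by (auto simp: cycle_presentation_def)
  \<comment> \<open>Common form of both profiles: \<open>c\<close> and \<open>d\<close> write out
    the long cycle of \<open>r_n\<close>, and \<open>A\<close> collects the remaining points, fixed
    by \<open>r_n\<close> and by \<open>\<nu>\<close>.\<close>
  obtain c d A where c: "c \<in> set cs" and d: "d \<in> set ds" and len: "length c = length d"
    and A: "\<And>x. x \<in> A \<Longrightarrow> \<nu> x = x \<and> ?r x = x"
    and cA: "set c = {1..n} - A" and dA: "set d = {1..n} - A"
    and nud: "\<And>t. t < length c \<Longrightarrow> \<nu> (c ! t) = d ! t"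
    using prof
  proof
    assume P: "profile n mul = {#1, n - 1#}"
    have "map length cs = [n - 1]"
      using natural_reordering_wrt_lengths[OF cs(1,2) P] by simp
    then obtain c where c: "cs = [c]" "length c = n - 1" by auto
    have "map length ds = [n - 1]"
      using natural_reordering_wrt_lengths[OF ds(1,2) P] by simp
    then obtain d where d: "ds = [d]" "length d = n - 1" by auto
    have "set c = {1..n} - {n}" "set d = {1..n} - {n}"
      using cs(1) ds(1) by (auto simp: cycle_presentation_def c d)
    moreover have "\<nu> (c ! t) = d ! t" if "t < length c" for t
      using cs(4)[of 0 t] ds(3)[of 0 t] that by (simp add: c d)
    ultimately show thesis using that[of c d "{n}"] c d cs(3) fixn by simp
  next
    assume P: "profile n mul = {#1, 1, n - 2#}"
    have srt: "map length xs = [1, n - 2]" if "map length xs = sorted_list_of_multiset {#1, n - 2#}"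
      "\<forall>l \<in> set (map length xs). 0 < l" for xs :: "nat list list"
    proof -
      \<comment> \<open>The order \<open>[n - 2, 1]\<close> would arise only for
        \<open>n - 2 = 0\<close>, which is excluded because cycles are nonempty.\<close>
      have "sorted_list_of_multiset {#1, n - 2#} = insort 1 [n - 2]" by simp
      then show ?thesis using that by (auto split: if_splits)
    qed
    have lc: "map length cs = [1, n - 2]"
      using srt[OF natural_reordering_wrt_lengths[OF cs(1,2) P] pos] .
    moreover have "map length ds = map length cs"
      using natural_reordering_wrt_lengths[OF ds(1,2) P]
        natural_reordering_wrt_lengths[OF cs(1,2) P] by simp
    ultimately obtain a c b d where c: "cs = [[a], c]" "length c = n - 2"
      and d: "ds = [[b], d]" "length d = n - 2"
      by (auto simp: map_eq_Cons_conv length_Suc_conv)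
    have fixa: "?r a = a" "?r b = b"
      using cycle_presentation_nth[OF cs(1), of "[a]" 0] cycle_presentation_nth[OF ds(1), of "[b]" 0]
      by (simp_all add: c d)
    have sc: "set c = {1..n} - {a, n}" "set d = {1..n} - {b, n}" "a \<noteq> n" "b \<noteq> n"
      and dist: "distinct d" and a: "a \<in> {1..n}"
      using cs(1) ds(1) by (auto simp: cycle_presentation_def c d)
    \<comment> \<open>Otherwise the fixed point \<open>a\<close> lies on the cycle \<open>d\<close>,
      which then has length 1. So \<open>r_n\<close> fixes all three points and is the identity, and
      connectedness leaves only the point \<open>n\<close>, contradicting
      \<open>a \<noteq> n\<close>.\<close>
    have ab: "a = b"
    proof (rule ccontr)
      assume "a \<noteq> b"
      then have "a \<in> set d" using sc a by auto
      then obtain i where i: "i < length d" "a = d ! i" by (metis in_set_conv_nth)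
      have "d ! i = d ! (Suc i mod length d)"
        using cycle_presentation_nth[OF ds(1), of d i] fixa i by (simp add: d)
      then have "i = Suc i mod length d"
        using dist i by (metis length_pos_if_in_set mod_less_divisor nth_eq_iff_index_eq nth_mem)
      then have l1: "length d = 1"
        using i(1) by (cases "Suc i = length d") auto
      then have "d = [a]" using i by (auto simp: length_Suc_conv)
      then have "{1..n} = {a, b, n}" using ds(1) by (auto simp: cycle_presentation_def d)
      then have "?r x = x" for x
        using fixa fixn by (cases "x \<in> {1..n}") (auto simp: right_mult_def)
      then have "?r = id" by auto
      then have "{1..n} = {n}" using quandle.quandle_connected_right_mult_id[OF Q conn nQ] by blast
      then show False using sc(3) a by simp
    qed
    have "\<nu> a = a"
      using cs(4)[of 0 0] ds(3)[of 0 0] by (simp add: c d ab)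
    moreover have "\<nu> (c ! t) = d ! t" if "t < length c" for t
      using cs(4)[of 1 t] ds(3)[of 1 t] that by (simp add: c d)
    ultimately show thesis
      using that[of c d "{a, n}"] c d cs(3) fixn fixa sc ab by auto
  qed
  have "d ! 0 \<in> set c"
  proof -
    have "d \<noteq> []" using d ds(1) by (auto simp: cycle_presentation_def)
    then show ?thesis using cA dA by (metis length_greater_0_conv nth_mem)
  qed
  then obtain k where k: "\<And>i. i < length c \<Longrightarrow> d ! i = (?r ^^ k) (c ! i)"
    using cycle_rotation[of c ?r d] cycle_presentation_nth[OF cs(1), of c]
      cycle_presentation_nth[OF ds(1), of d] c d len by (metis UnI1 set_append)
  have "\<nu> x = (?r ^^ k) x" for x
  proof -
    consider "x \<notin> {1..n}" | "x \<in> A" | "x \<in> set c" using cA by blast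
    then show ?thesis
    proof cases
      case 1
      then show ?thesis
        using permutes_not_in[OF perm] permutes_not_in[OF permutes_funpow[OF r]] by simp
    next
      case 2
      then show ?thesis using A rn by simp
    next
      case 3
      then show ?thesis using nud k by (metis in_set_conv_nth)
    qed
  qed
  then show thesis using that by blast
qed

theorem corollary1p8:
  fixes n :: nat and mul :: "nat \<Rightarrow> nat \<Rightarrow> nat"
  assumes "quandle {1..n} mul"
    and "quandle_connected {1..n} mul"
    and "naturally_ordered n mul"
    and "profile n mul = {#1, n - 1#} \<or> profile n mul = {#1, 1, n - 2#}"
  shows "{f. quandle_aut {1..n} mul f} = {\<nu>. natural_reordering n mul \<nu>}"
proof -
  interpret quandle "{1..n}" mul by fact
  have id: "natural_reordering_wrt n mul n id"
    using assms(3) by (rule naturally_ordered_reordering)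
  then have n: "n \<in> {1..n}"
    by (auto simp: natural_reordering_wrt_def cycle_presentation_def)
  have "natural_reordering n mul f" if f: "quandle_aut {1..n} mul f" for f
  proof -
    have p: "f permutes {1..n}" using f by (simp add: quandle_aut_def)
    \<comment> \<open>Transporting the identity along \<open>inv f\<close> gives back
      \<open>f\<close>, now with respect to \<open>r_q\<close> for
      \<open>q = inv f n\<close>.\<close>
    have "natural_reordering_wrt n mul (inv f n) (id \<circ> inv (inv f))"
      using natural_reordering_wrt_aut[OF id quandle_aut_inv[OF f] n] .
    moreover have "inv f n \<in> {1..n}" using permutes_in_image[OF permutes_inv[OF p]] n by blast
    ultimately show ?thesis
      using permutes_inv_inv[OF p] by (auto simp: natural_reordering_def)
  qed
  moreover have "quandle_aut {1..n} mul \<nu>" if nu: "natural_reordering n mul \<nu>" for \<nu>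
  proof -
    obtain q where q: "q \<in> {1..n}" "natural_reordering_wrt n mul q \<nu>"
      using nu by (auto simp: natural_reordering_def)
    obtain g where g: "quandle_aut {1..n} mul g" "g q = n"
      using quandle_connected_aut[OF assms(2) q(1) n] .
    have "natural_reordering_wrt n mul n (\<nu> \<circ> inv g)"
      using natural_reordering_wrt_aut[OF q(2) g(1) q(1)] g(2) by simp
    then obtain k where "\<nu> \<circ> inv g = right_mult {1..n} mul n ^^ k"
      using natural_reordering_wrt_self_power[OF assms] by blast
    then have "quandle_aut {1..n} mul (\<nu> \<circ> inv g)"
      using quandle_aut_funpow[OF quandle_aut_right_mult[OF n]] by simp
    \<comment> \<open>Composing with \<open>g\<close> undoes the transport from \<open>q\<close> to
      \<open>n\<close> and recovers \<open>\<nu>\<close>.\<close>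
    then have "quandle_aut {1..n} mul (\<nu> \<circ> inv g \<circ> g)" using g(1) by (rule quandle_aut_comp)
    moreover have "\<nu> \<circ> inv g \<circ> g = \<nu>"
      using g(1) by (auto simp: quandle_aut_def permutes_inverses)
    ultimately show ?thesis by simp
  qed
  ultimately show ?thesis by blast
qed

end
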